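(* Let $M,\kappa\ge 1$ be integers and $\delta>0$, $\eta>0$, $p_t,p_r,p_{syn}>0$ be fixed. For $\varepsilon\in(0,1)$ let $p_{0,\mathrm{sc}}^*,r_{0,\mathrm{sc}}^*$ and $p_{0,\mathrm{ssc}}^*,r_{0,\mathrm{ssc}}^*$ be the optimum transmit power and rate, with no constraints on power and rate, under the SC and SSC schemes, as defined in the context. Then $$\lim_{\varepsilon\to 0^+}\frac{r_{0,\mathrm{ssc}}^*}{r_{0,\mathrm{sc}}^*}=\lim_{\varepsilon\to 0^+}\frac{p_{0,\mathrm{ssc}}^*}{p_{0,\mathrm{sc}}^*}=\sqrt{\frac{p_t+p_r+p_{syn}}{p_t+Mp_r+p_{syn}}}.$$
   Context: Put $P_{\mathrm{sc}}=p_t+Mp_r+p_{syn}$ and $P_{\mathrm{ssc}}=p_t+p_r+p_{syn}$ (the circuit powers of SC = selection combining, and SSC = switch and stay combining), and, for both schemes, $$\omega=\kappa\delta\big((1-\varepsilon^{1/M})^{-1/\kappa}-1\big).$$ For each scheme $s\in\{\mathrm{sc},\mathrm{ssc}\}$, $p_{0,s}^*$ is the maximizer over $p>0$ of the energy efficiency $\frac{(1-\varepsilon)\log_2(1+\omega p)}{p/\eta+P_s}$ and $r_{0,s}^*=\log_2(1+\omega p_{0,s}^* )$. In closed form, $r_{0,s}^*=\frac{1}{\ln 2}\big(\mathcal{W}\big(\frac{\omega\eta P_s-1}{e}\big)+1\big)$ and $p_{0,s}^*=(2^{r_{0,s}^*}-1)/\omega$, where $\mathcal{W}$ is the main branch (values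 $\ge -1$) of the Lambert W function. Here $M$ is the number of receive antennas, $\kappa$ the number of interferers, $\varepsilon$ the target outage probability, and $\eta$ the amplifier drain efficiency. *)

theory Defs
  imports Complex_Main
begin

text \<open>
  Parameters: \<open>M\<close> receive antennas, \<open>\<kappa>\<close> interferers, \<open>\<delta>\<close> the constant in \<open>\<omega>\<close>,
  target outage probability \<open>\<epsilon>\<close>, amplifier drain efficiency \<open>\<eta>\<close>, and the
  power consumptions \<open>pt\<close>, \<open>pr\<close>, \<open>psyn\<close> entering the circuit power of a scheme.
\<close>

text \<open>Selection combining (all \<open>M\<close> branches powered) and switch and stay combining (one branch).\<close>

datatype scheme = SC | SSC

fun circuit_power :: "scheme \<Rightarrow> nat \<Rightarrow> real \<Rightarrow> real \<Rightarrow> real \<Rightarrow> real" where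
  "circuit_power SC M pt pr psyn = pt + real M * pr + psyn"
| "circuit_power SSC M pt pr psyn = pt + pr + psyn"

definition omega :: "nat \<Rightarrow> nat \<Rightarrow> real \<Rightarrow> real \<Rightarrow> real" where
  "omega M \<kappa> \<delta> \<epsilon> =
     real \<kappa> * \<delta> * ((1 - \<epsilon> powr (1 / real M)) powr (- 1 / real \<kappa>) - 1)"

definition energy_efficiency :: "real \<Rightarrow> real \<Rightarrow> real \<Rightarrow> real \<Rightarrow> real \<Rightarrow> real" where
  "energy_efficiency \<epsilon> \<omega> \<eta> P p = (1 - \<epsilon>) * log 2 (1 + \<omega> * p) / (p / \<eta> + P)"

text \<open>
  For \<open>0 < \<epsilon> < 1\<close> and positive parameters the efficiency has exactly one maximizer on the positive
  reals, so the choice made by \<open>arg_max_on\<close> is immaterial there.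
\<close>

definition opt_power ::
  "scheme \<Rightarrow> nat \<Rightarrow> nat \<Rightarrow> real \<Rightarrow> real \<Rightarrow> real \<Rightarrow> real \<Rightarrow> real \<Rightarrow> real \<Rightarrow> real" where
  "opt_power s M \<kappa> \<delta> \<eta> pt pr psyn \<epsilon> =
     arg_max_on
       (energy_efficiency \<epsilon> (omega M \<kappa> \<delta> \<epsilon>) \<eta> (circuit_power s M pt pr psyn)) {0<..}"

definition opt_rate ::
  "scheme \<Rightarrow> nat \<Rightarrow> nat \<Rightarrow> real \<Rightarrow> real \<Rightarrow> real \<Rightarrow> real \<Rightarrow> real \<Rightarrow> real \<Rightarrow> real" where
  "opt_rate s M \<kappa> \<delta> \<eta> pt pr psyn \<epsilon> =
     log 2 (1 + omega M \<kappa> \<delta> \<epsilon> * opt_power s M \<kappa> \<delta> \<eta> pt pr psyn \<epsilon>)"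

end

theory Submission
  imports Defs "HOL-Real_Asymp.Real_Asymp"
begin

text \<open>
  In the variable \<open>x = \<omega> * p\<close> the efficiency is a positive multiple of
  \<open>ln (1 + x) / (x + \<omega> * \<eta> * P)\<close>, and the first-order condition for its maximum is
  \<open>(1 + x) * ln (1 + x) - x = \<omega> * \<eta> * P\<close>. The left-hand side is \<open>x\<^sup>2 / 2 + o(x\<^sup>2)\<close> at \<open>0\<close>, and
  \<open>\<omega>\<close> tends to \<open>0\<close> with \<open>\<epsilon>\<close>, so \<open>x\<close> is asymptotic to \<open>sqrt (2 * \<omega> * \<eta> * P)\<close>. As \<open>\<omega>\<close> is the same
  for both schemes, only \<open>sqrt P\<close> survives in the ratio of the powers; the rates have the same
  ratio because \<open>ln (1 + x)\<close> is asymptotic to \<open>x\<close>.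
\<close>

definition stationary :: "real \<Rightarrow> real" where
  "stationary x = (1 + x) * ln (1 + x) - x"

text \<open>This is the strict form of \<open>ln v \<le> v - 1\<close> at
  \<open>v = 1 / (1 + x)\<close>, multiplied by \<open>1 + x\<close>.\<close>

lemma stationary_pos:
  assumes "x > 0"
  shows "stationary x > 0"
proof -
  have "ln (1 / (1 + x)) \<noteq> 1 / (1 + x) - 1"
    using ln_eq_minus_one[of "1 / (1 + x)"] assms by auto
  with ln_le_minus_one[of "1 / (1 + x)"] assms have "ln (1 / (1 + x)) < 1 / (1 + x) - 1"
    by simp
  then show ?thesis
    using assms by (simp add: stationary_def ln_div field_simps)
qed

text \<open>Intermediate value theorem on \<open>{0..b}\<close>, starting from
  \<open>stationary 0 = 0\<close>. The bound \<open>x \<le> b\<close> is recorded because small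
  values of \<open>b\<close> later force the maximizers to 0.\<close>

lemma stationary_solution:
  assumes "0 < a" "a \<le> stationary b" "0 < b"
  obtains x where "0 < x" "x \<le> b" "stationary x = a"
proof -
  have "continuous_on {0..b} stationary"
    unfolding stationary_def by (intro continuous_intros) auto
  moreover have "stationary 0 = 0"
    by (simp add: stationary_def)
  ultimately obtain x where x: "0 \<le> x" "x \<le> b" "stationary x = a"
    using IVT'[of stationary 0 a b] assms by auto
  with \<open>0 < a\<close> \<open>stationary 0 = 0\<close> have "x \<noteq> 0"
    by auto
  with x that show ?thesis
    by force
qed

text \<open>Concavity suffices: at a stationary point \<open>x\<close> the tangent of \<open>ln (1 + y)\<close> is
  \<open>(y + a) / (1 + x)\<close>, so it vanishes at \<open>y = - a\<close>.\<close>

lemma log_quotient_less: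
  assumes "x > 0" "y > 0" "y \<noteq> x" "a > 0" "stationary x = a"
  shows "ln (1 + y) / (y + a) < ln (1 + x) / (x + a)"
proof -
  \<comment> \<open>Dividing by \<open>1 + x\<close> moves the point of tangency to 1, where
    \<open>ln u < u - 1\<close> is strict for \<open>u \<noteq> 1\<close>.\<close>
  define u where "u = (1 + y) / (1 + x)"
  have u: "u > 0" "u \<noteq> 1"
    using assms by (auto simp: u_def field_simps)
  then have "ln u < u - 1"
    using ln_le_minus_one[of u] ln_eq_minus_one[of u] by fastforce
  moreover have "ln u = ln (1 + y) - ln (1 + x)"
    using assms by (simp add: u_def ln_div)
  moreover have lnx: "ln (1 + x) = (x + a) / (1 + x)"
    using assms by (simp add: stationary_def field_simps)
  ultimately have "ln (1 + y) < (x + a) / (1 + x) + (u - 1)"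
    by simp
  also have "u - 1 = (y - x) / (1 + x)"
    using assms by (simp add: u_def divide_simps)
  also have "(x + a) / (1 + x) + (y - x) / (1 + x) = (y + a) / (1 + x)"
    by (simp add: add_divide_distrib[symmetric])
  finally have "ln (1 + y) / (y + a) < 1 / (1 + x)"
    using assms by (simp add: field_simps)
  also have "\<dots> = ln (1 + x) / (x + a)"
    using assms by (simp add: lnx)
  finally show ?thesis .
qed

lemma energy_efficiency_eq:
  assumes "\<omega> > 0" "\<eta> > 0" "P > 0" "p > 0"
  shows "energy_efficiency \<epsilon> \<omega> \<eta> P p =
    (1 - \<epsilon>) * \<omega> * \<eta> / ln 2 * (ln (1 + \<omega> * p) / (\<omega> * p + \<omega> * \<eta> * P))"
proof -
  have "\<omega> * p + \<omega> * \<eta> * P = \<omega> * \<eta> * (p / \<eta> + P)"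
    using assms by (simp add: field_simps)
  moreover have "p / \<eta> + P > 0"
    using assms by (simp add: add_pos_pos)
  ultimately show ?thesis
    using assms by (simp add: energy_efficiency_def log_def)
qed

text \<open>The strict comparison with every other \<open>p > 0\<close> shows both that
  \<open>x / \<omega>\<close> is a maximizer and that it is the only one, which determines the
  choice behind \<open>arg_max_on\<close>.\<close>

lemma arg_max_energy_efficiency:
  assumes "\<epsilon> < 1" "\<omega> > 0" "\<eta> > 0" "P > 0" "x > 0" "stationary x = \<omega> * \<eta> * P"
  shows "arg_max_on (energy_efficiency \<epsilon> \<omega> \<eta> P) {0<..} = x / \<omega>"
proof -
  let ?E = "energy_efficiency \<epsilon> \<omega> \<eta> P"
  have less: "?E p < ?E (x / \<omega>)" if "p > 0" "p \<noteq> x / \<omega>" for p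
  proof -
    have "ln (1 + \<omega> * p) / (\<omega> * p + \<omega> * \<eta> * P) < ln (1 + x) / (x + \<omega> * \<eta> * P)"
      using assms that by (intro log_quotient_less) (auto simp: field_simps)
    moreover have "(1 - \<epsilon>) * \<omega> * \<eta> / ln 2 > 0"
      using assms by simp
    ultimately have "(1 - \<epsilon>) * \<omega> * \<eta> / ln 2 * (ln (1 + \<omega> * p) / (\<omega> * p + \<omega> * \<eta> * P)) <
        (1 - \<epsilon>) * \<omega> * \<eta> / ln 2 * (ln (1 + x) / (x + \<omega> * \<eta> * P))"
      by (rule mult_strict_left_mono)
    then show ?thesis
      using assms that by (simp add: energy_efficiency_eq)
  qed
  have "x / \<omega> > 0"
    using assms by simp
  show ?thesis
    unfolding arg_max_on_def arg_max_def
  proof (rule some_equality)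
    show "is_arg_max ?E (\<lambda>p. p \<in> {0<..}) (x / \<omega>)"
      unfolding is_arg_max_def using less \<open>x / \<omega> > 0\<close>
      by (metis greaterThan_iff less_asym)
    show "p = x / \<omega>" if "is_arg_max ?E (\<lambda>p. p \<in> {0<..}) p" for p
      using that less \<open>x / \<omega> > 0\<close> unfolding is_arg_max_def by (metis greaterThan_iff)
  qed
qed

lemma omega_pos:
  assumes "M \<ge> 1" "\<kappa> \<ge> 1" "\<delta> > 0" "0 < \<epsilon>" "\<epsilon> < 1"
  shows "omega M \<kappa> \<delta> \<epsilon> > 0"
proof -
  have "\<epsilon> powr (1 / real M) < 1"
    using assms powr_less_mono2[of "1 / real M" \<epsilon> 1] by simp
  moreover have "\<epsilon> powr (1 / real M) > 0"
    using assms by simp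
  ultimately have "(1 - \<epsilon> powr (1 / real M)) powr (- 1 / real \<kappa>) > 1"
    using assms powr_less_mono2_neg[of "- 1 / real \<kappa>" "1 - \<epsilon> powr (1 / real M)" 1] by simp
  then show ?thesis
    using assms by (simp add: omega_def)
qed

lemma omega_tendsto_0:
  assumes "M \<ge> 1"
  shows "(omega M \<kappa> \<delta> \<longlongrightarrow> 0) (at_right 0)"
proof -
  have "1 / real M > 0"
    using assms by simp
  then have "((\<lambda>\<epsilon>::real. \<epsilon> powr (1 / real M)) \<longlongrightarrow> 0) (at_right 0)"
    by real_asymp
  then have "((\<lambda>\<epsilon>. real \<kappa> * \<delta> * ((1 - \<epsilon> powr (1 / real M)) powr (- 1 / real \<kappa>) - 1))
      \<longlongrightarrow> real \<kappa> * \<delta> * ((1 - 0) powr (- 1 / real \<kappa>) - 1)) (at_right 0)"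
    by (intro tendsto_intros) auto
  then show ?thesis
    by (simp add: omega_def[abs_def])
qed

text \<open>As \<open>omega\<close> tends to 0, the right-hand side of the stationarity equation
  drops below \<open>stationary b\<close>, so a root exists in \<open>(0, b]\<close>; divided by
  \<open>omega\<close>, it is the unique maximizer.\<close>

lemma opt_power_stationary:
  assumes "M \<ge> 1" "\<kappa> \<ge> 1" "\<delta> > 0" "\<eta> > 0" "circuit_power s M pt pr psyn > 0" "b > 0"
  defines "x \<equiv> \<lambda>\<epsilon>. omega M \<kappa> \<delta> \<epsilon> * opt_power s M \<kappa> \<delta> \<eta> pt pr psyn \<epsilon>"
  shows "\<forall>\<^sub>F \<epsilon> in at_right 0. 0 < x \<epsilon> \<and> x \<epsilon> \<le> b \<and>
    stationary (x \<epsilon>) = omega M \<kappa> \<delta> \<epsilon> * \<eta> * circuit_power s M pt pr psyn"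
proof -
  define P where "P = circuit_power s M pt pr psyn"
  have "((\<lambda>\<epsilon>. omega M \<kappa> \<delta> \<epsilon> * \<eta> * P) \<longlongrightarrow> 0 * \<eta> * P) (at_right 0)"
    by (intro tendsto_intros omega_tendsto_0 assms)
  then have "\<forall>\<^sub>F \<epsilon> in at_right 0. omega M \<kappa> \<delta> \<epsilon> * \<eta> * P < stationary b"
    using stationary_pos[OF \<open>b > 0\<close>] by (intro order_tendstoD(2)) auto
  moreover have "\<forall>\<^sub>F \<epsilon> in at_right 0. \<epsilon> \<in> {0<..<1::real}"
    by (rule eventually_at_right_real) simp
  ultimately show ?thesis
  proof eventually_elim
    case (elim \<epsilon>)
    have pos: "omega M \<kappa> \<delta> \<epsilon> > 0" "P > 0"
      using elim assms by (auto intro: omega_pos simp: P_def)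
    then obtain y where y: "0 < y" "y \<le> b" "stationary y = omega M \<kappa> \<delta> \<epsilon> * \<eta> * P"
      using stationary_solution[of "omega M \<kappa> \<delta> \<epsilon> * \<eta> * P" b] elim assms by auto
    then have "x \<epsilon> = y"
      using arg_max_energy_efficiency[of \<epsilon> "omega M \<kappa> \<delta> \<epsilon>" \<eta> P y] elim assms pos
      by (simp add: x_def opt_power_def P_def)
    with y show ?case
      by (simp add: P_def)
  qed
qed

text \<open>Dividing the two equations cancels \<open>w\<close> and leaves
  \<open>stationary (x t) / stationary (y t) = P / Q\<close>, while \<open>stationary u\<close>
  behaves like \<open>u^2 / 2\<close> and \<open>ln (1 + u)\<close> like \<open>u\<close> near
  0.\<close>

lemma stationary_ratio_limits:
  fixes x y w :: "real \<Rightarrow> real"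
  assumes x: "filterlim x (at_right 0) F" and y: "filterlim y (at_right 0) F"
    and eq: "\<forall>\<^sub>F t in F. w t \<noteq> 0 \<and> stationary (x t) = w t * P \<and> stationary (y t) = w t * Q"
    and "P > 0" "Q > 0"
  shows "((\<lambda>t. x t / y t) \<longlongrightarrow> sqrt (P / Q)) F"
    and "((\<lambda>t. ln (1 + x t) / ln (1 + y t)) \<longlongrightarrow> sqrt (P / Q)) F"
proof -
  have pos: "\<forall>\<^sub>F t in F. x t > 0" "\<forall>\<^sub>F t in F. y t > 0"
    using x y by (auto simp: filterlim_at elim: eventually_mono)
  have "((\<lambda>u. stationary u / u\<^sup>2) \<longlongrightarrow> 1 / 2) (at_right 0)"
    unfolding stationary_def by real_asymp
  note quad = filterlim_compose[OF this]
  \<comment> \<open>Since \<open>P / Q\<close> is eventually the quotient of the two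
    \<open>stationary\<close> values, this product is then exactly
    \<open>(x t / y t)^2\<close>.\<close>
  have "((\<lambda>t. P / Q * ((stationary (y t) / (y t)\<^sup>2) / (stationary (x t) / (x t)\<^sup>2)))
      \<longlongrightarrow> P / Q * ((1 / 2) / (1 / 2))) F"
    by (intro tendsto_intros quad x y) simp
  then have "((\<lambda>t. sqrt (P / Q * ((stationary (y t) / (y t)\<^sup>2) / (stationary (x t) / (x t)\<^sup>2))))
      \<longlongrightarrow> sqrt (P / Q)) F"
    by (intro tendsto_real_sqrt) simp
  moreover have "\<forall>\<^sub>F t in F. sqrt (P / Q * ((stationary (y t) / (y t)\<^sup>2) / (stationary (x t) / (x t)\<^sup>2)))
      = x t / y t"
    using eq pos
  proof eventually_elim
    case (elim t)
    then have "P / Q * ((stationary (y t) / (y t)\<^sup>2) / (stationary (x t) / (x t)\<^sup>2)) = (x t / y t)\<^sup>2"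
      using assms by (simp add: field_simps)
    with elim show ?case
      by (simp add: real_sqrt_divide)
  qed
  ultimately show ratio: "((\<lambda>t. x t / y t) \<longlongrightarrow> sqrt (P / Q)) F"
    by (rule Lim_transform_eventually)
  have "((\<lambda>u::real. ln (1 + u) / u) \<longlongrightarrow> 1) (at_right 0)"
    by real_asymp
  note lin = filterlim_compose[OF this]
  have "((\<lambda>t. (ln (1 + x t) / x t) / (ln (1 + y t) / y t) * (x t / y t))
      \<longlongrightarrow> 1 / 1 * sqrt (P / Q)) F"
    by (intro tendsto_intros lin x y ratio) simp
  moreover have "\<forall>\<^sub>F t in F. (ln (1 + x t) / x t) / (ln (1 + y t) / y t) * (x t / y t)
      = ln (1 + x t) / ln (1 + y t)"
    using pos by eventually_elim simp
  ultimately show "((\<lambda>t. ln (1 + x t) / ln (1 + y t)) \<longlongrightarrow> sqrt (P / Q)) F"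
    by (auto intro: Lim_transform_eventually)
qed

theorem mainTheorem6:
  fixes M \<kappa> :: nat and \<delta> \<eta> pt pr psyn :: real
  assumes "M \<ge> 1" and "\<kappa> \<ge> 1"
    and "\<delta> > 0" and "\<eta> > 0"
    and "pt > 0" and "pr > 0" and "psyn > 0"
  shows "((\<lambda>\<epsilon>. opt_rate SSC M \<kappa> \<delta> \<eta> pt pr psyn \<epsilon> / opt_rate SC M \<kappa> \<delta> \<eta> pt pr psyn \<epsilon>)
            \<longlongrightarrow> sqrt ((pt + pr + psyn) / (pt + real M * pr + psyn))) (at_right 0)
       \<and> ((\<lambda>\<epsilon>. opt_power SSC M \<kappa> \<delta> \<eta> pt pr psyn \<epsilon> / opt_power SC M \<kappa> \<delta> \<eta> pt pr psyn \<epsilon>)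
            \<longlongrightarrow> sqrt ((pt + pr + psyn) / (pt + real M * pr + psyn))) (at_right 0)"
proof -
  define P where "P s = circuit_power s M pt pr psyn" for s
  define x where "x s \<epsilon> = omega M \<kappa> \<delta> \<epsilon> * opt_power s M \<kappa> \<delta> \<eta> pt pr psyn \<epsilon>" for s \<epsilon>
  have P: "P s > 0" for s
    using assms by (cases s) (auto simp: P_def intro!: add_pos_pos add_pos_nonneg)
  have x: "\<forall>\<^sub>F \<epsilon> in at_right 0. 0 < x s \<epsilon> \<and> x s \<epsilon> \<le> b \<and>
      stationary (x s \<epsilon>) = omega M \<kappa> \<delta> \<epsilon> * \<eta> * P s" if "b > 0" for s b
    using opt_power_stationary[of M \<kappa> \<delta> \<eta> s pt pr psyn b] assms P[of s] that
    by (simp add: x_def P_def)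
  have lim: "filterlim (x s) (at_right 0) (at_right 0)" for s
  proof (rule tendsto_imp_filterlim_at_right)
    show "(x s \<longlongrightarrow> 0) (at_right 0)"
    proof (rule tendstoI)
      fix e :: real
      assume "e > 0"
      \<comment> \<open>The bound by \<open>b\<close> is not strict, hence \<open>e / 2\<close> to
        get below \<open>e\<close>.\<close>
      then show "\<forall>\<^sub>F \<epsilon> in at_right 0. dist (x s \<epsilon>) 0 < e"
        using x[of "e / 2" s] by (auto elim: eventually_mono)
    qed
    show "\<forall>\<^sub>F \<epsilon> in at_right 0. 0 < x s \<epsilon>"
      using x[of 1 s] by (auto elim: eventually_mono)
  qed
  have "\<forall>\<^sub>F \<epsilon> in at_right 0. \<epsilon> \<in> {0<..<1::real}"
    by (rule eventually_at_right_real) simp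
  then have omega: "\<forall>\<^sub>F \<epsilon> in at_right 0. omega M \<kappa> \<delta> \<epsilon> > 0"
    by eventually_elim (use assms omega_pos in auto)
  \<comment> \<open>The common factor \<open>w\<close> is \<open>omega * \<eta>\<close>; the schemes
    differ only in \<open>P\<close>.\<close>
  have eq: "\<forall>\<^sub>F \<epsilon> in at_right 0. omega M \<kappa> \<delta> \<epsilon> * \<eta> \<noteq> 0
      \<and> stationary (x SSC \<epsilon>) = omega M \<kappa> \<delta> \<epsilon> * \<eta> * P SSC
      \<and> stationary (x SC \<epsilon>) = omega M \<kappa> \<delta> \<epsilon> * \<eta> * P SC"
    using x[OF zero_less_one, of SSC] x[OF zero_less_one, of SC] omega
    by eventually_elim (use assms in auto)
  have limits:
    "((\<lambda>\<epsilon>. x SSC \<epsilon> / x SC \<epsilon>) \<longlongrightarrow> sqrt (P SSC / P SC)) (at_right 0)"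
    "((\<lambda>\<epsilon>. ln (1 + x SSC \<epsilon>) / ln (1 + x SC \<epsilon>)) \<longlongrightarrow> sqrt (P SSC / P SC)) (at_right 0)"
    by (intro stationary_ratio_limits[OF lim lim eq] P)+
  have "\<forall>\<^sub>F \<epsilon> in at_right 0. x SSC \<epsilon> / x SC \<epsilon> =
      opt_power SSC M \<kappa> \<delta> \<eta> pt pr psyn \<epsilon> / opt_power SC M \<kappa> \<delta> \<eta> pt pr psyn \<epsilon>"
    using omega by eventually_elim (simp add: x_def)
  with limits(1) have "((\<lambda>\<epsilon>. opt_power SSC M \<kappa> \<delta> \<eta> pt pr psyn \<epsilon> /
      opt_power SC M \<kappa> \<delta> \<eta> pt pr psyn \<epsilon>) \<longlongrightarrow> sqrt (P SSC / P SC)) (at_right 0)"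
    by (rule Lim_transform_eventually)
  \<comment> \<open>The factors \<open>ln 2\<close> of the two logarithms cancel for every
    \<open>\<epsilon>\<close>, so this is an equality of functions and not only an eventual
    one.\<close>
  moreover have "(\<lambda>\<epsilon>. ln (1 + x SSC \<epsilon>) / ln (1 + x SC \<epsilon>)) =
      (\<lambda>\<epsilon>. opt_rate SSC M \<kappa> \<delta> \<eta> pt pr psyn \<epsilon> / opt_rate SC M \<kappa> \<delta> \<eta> pt pr psyn \<epsilon>)"
    by (simp add: opt_rate_def x_def log_def)
  ultimately show ?thesis
    using limits(2) by (simp add: P_def)
qed

end
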